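(* Let $p$ be a prime, let $r,e,m\ge1$ and $s\ge0$ be integers with $\gcd(m,p)=1$, put $n=mp^s$ and $R=\mathbb{F}_{p^r}[u]/\langle u^e\rangle$. Let $\lambda\in\mathbb{F}_{p^r}^*$ be a $p^sm$-th power in $\mathbb{F}_{p^r}$. Then every $\lambda$-constacyclic code of length $n$ over $R$ is equivalent to a cyclic code of length $n$ over $R$.
   Context: $R=\mathbb{F}_{p^r}[u]/\langle u^e\rangle=\mathbb{F}_{p^r}+u\mathbb{F}_{p^r}+\cdots+u^{e-1}\mathbb{F}_{p^r}$ with $u^e=0$. For a unit $\lambda\in R$, a $\lambda$-constacyclic code of length $n$ over $R$ is an $R$-submodule of $R^n$ closed under $(c_0,\dots,c_{n-1})\mapsto(\lambda c_{n-1},c_0,\dots,c_{n-2})$; a cyclic code is a $1$-constacyclic code. Two linear codes of the same length over $R$ are equivalent if one is obtained from the other by a monomial transformation, i.e. a permutation of coordinates combined with multiplication of each coordinate by a unit of $R$. *)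

theory Defs
  imports
    "HOL-Computational_Algebra.Primes"
    "HOL-Combinatorics.Permutations"
    "HOL-Algebra.UnivPoly"
    "HOL-Algebra.QuotRing"
begin

definition u_ideal :: "('a, 'b) ring_scheme \<Rightarrow> nat \<Rightarrow> (nat \<Rightarrow> 'a) set" where
  "u_ideal F e = PIdl\<^bsub>UP F\<^esub> (monom (UP F) \<one>\<^bsub>F\<^esub> e)"

text \<open>The ring \<open>F[u]/\<langle>u\<^sup>e\<rangle>\<close>; its elements are cosets of \<open>\<langle>u\<^sup>e\<rangle>\<close>.\<close>

definition trunc_poly_ring :: "('a, 'b) ring_scheme \<Rightarrow> nat \<Rightarrow> (nat \<Rightarrow> 'a) set ring" where
  "trunc_poly_ring F e = UP F Quot u_ideal F e"

text \<open>The inclusion of \<open>F\<close> into \<open>F[u]/\<langle>u\<^sup>e\<rangle>\<close>: a scalar goes to the coset of the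
  corresponding constant polynomial.\<close>

definition scalar_incl :: "('a, 'b) ring_scheme \<Rightarrow> nat \<Rightarrow> 'a \<Rightarrow> (nat \<Rightarrow> 'a) set" where
  "scalar_incl F e a = u_ideal F e +>\<^bsub>UP F\<^esub> monom (UP F) a 0"

text \<open>The module \<open>R\<^sup>n\<close>, a vector being a function on \<open>{..<n}\<close> that is \<^term>\<open>undefined\<close>
  elsewhere. The fields \<^const>\<open>mult\<close> and \<^const>\<open>one\<close>, which the record type inherits from
  rings, play no role in the module structure.\<close>

definition free_module :: "('r, 'b) ring_scheme \<Rightarrow> nat \<Rightarrow> ('r, nat \<Rightarrow> 'r) module" where
  "free_module R n =
    \<lparr>carrier = {..<n} \<rightarrow>\<^sub>E carrier R,
     mult = (\<lambda>x y. \<lambda>i\<in>{..<n}. x i \<otimes>\<^bsub>R\<^esub> y i),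
     one = (\<lambda>i\<in>{..<n}. \<one>\<^bsub>R\<^esub>),
     zero = (\<lambda>i\<in>{..<n}. \<zero>\<^bsub>R\<^esub>),
     add = (\<lambda>x y. \<lambda>i\<in>{..<n}. x i \<oplus>\<^bsub>R\<^esub> y i),
     smult = (\<lambda>a x. \<lambda>i\<in>{..<n}. a \<otimes>\<^bsub>R\<^esub> x i)\<rparr>"

lemma free_module_is_module:
  assumes "cring R"
  shows "module R (free_module R n)"
proof -
  interpret cring R by fact
  have neg: "\<exists>y \<in> {..<n} \<rightarrow>\<^sub>E carrier R.
      (\<lambda>i\<in>{..<n}. y i \<oplus>\<^bsub>R\<^esub> x i) = (\<lambda>i\<in>{..<n}. \<zero>\<^bsub>R\<^esub>)"
    if "x \<in> {..<n} \<rightarrow>\<^sub>E carrier R" for x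
    using that
    by (intro bexI[of _ "\<lambda>i\<in>{..<n}. \<ominus>\<^bsub>R\<^esub> x i"])
      (auto simp: PiE_iff l_neg intro!: restrict_ext)
  have "abelian_group (free_module R n)"
    by (intro abelian_groupI)
      (use neg in \<open>auto simp: free_module_def PiE_iff a_ac extensional_def
        intro!: ext\<close>)
  then show ?thesis
    by (intro moduleI assms)
      (auto simp: free_module_def PiE_iff l_distr r_distr m_assoc extensional_def intro!: ext)
qed

definition linear_code :: "('r, 'b) ring_scheme \<Rightarrow> nat \<Rightarrow> (nat \<Rightarrow> 'r) set \<Rightarrow> bool" where
  "linear_code R n C \<longleftrightarrow> submodule C R (free_module R n)"

definition constacyclic_shift ::
    "('r, 'b) ring_scheme \<Rightarrow> nat \<Rightarrow> 'r \<Rightarrow> (nat \<Rightarrow> 'r) \<Rightarrow> nat \<Rightarrow> 'r" where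
  "constacyclic_shift R n l c =
    (\<lambda>i\<in>{..<n}. if i = 0 then l \<otimes>\<^bsub>R\<^esub> c (n - 1) else c (i - 1))"

text \<open>The parameter \<open>l\<close> is meant to be a unit of \<open>R\<close>; the predicate does not
  impose this. Nonzero scalars of a field are units of \<open>F[u]/\<langle>u\<^sup>e\<rangle>\<close>: see
  \<open>scalar_incl_Units\<close> below.\<close>

definition constacyclic_code ::
    "('r, 'b) ring_scheme \<Rightarrow> nat \<Rightarrow> 'r \<Rightarrow> (nat \<Rightarrow> 'r) set \<Rightarrow> bool" where
  "constacyclic_code R n l C \<longleftrightarrow>
    linear_code R n C \<and> (\<forall>c\<in>C. constacyclic_shift R n l c \<in> C)"

definition cyclic_code :: "('r, 'b) ring_scheme \<Rightarrow> nat \<Rightarrow> (nat \<Rightarrow> 'r) set \<Rightarrow> bool" where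
  "cyclic_code R n C \<longleftrightarrow> constacyclic_code R n \<one>\<^bsub>R\<^esub> C"

definition monomial_map ::
    "('r, 'b) ring_scheme \<Rightarrow> nat \<Rightarrow> (nat \<Rightarrow> nat) \<Rightarrow> (nat \<Rightarrow> 'r) \<Rightarrow> (nat \<Rightarrow> 'r) \<Rightarrow> nat \<Rightarrow> 'r" where
  "monomial_map R n \<pi> a c = (\<lambda>i\<in>{..<n}. a i \<otimes>\<^bsub>R\<^esub> c (\<pi> i))"

definition equivalent_codes ::
    "('r, 'b) ring_scheme \<Rightarrow> nat \<Rightarrow> (nat \<Rightarrow> 'r) set \<Rightarrow> (nat \<Rightarrow> 'r) set \<Rightarrow> bool" where
  "equivalent_codes R n C D \<longleftrightarrow>
    linear_code R n C \<and> linear_code R n D \<and>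
    (\<exists>\<pi> a. \<pi> permutes {..<n} \<and> a \<in> {..<n} \<rightarrow> Units R \<and> D = monomial_map R n \<pi> a ` C)"

lemma u_ideal_ideal:
  assumes "cring F"
  shows "ideal (u_ideal F e) (UP F)"
proof -
  interpret UP_cring F "UP F" using assms by (simp add: UP_cring_def)
  show ?thesis
    unfolding u_ideal_def by (intro P.cgenideal_ideal monom_closed) simp
qed

lemma trunc_poly_ring_is_cring:
  assumes "cring F"
  shows "cring (trunc_poly_ring F e)"
proof -
  interpret UP_cring F "UP F" using assms by (simp add: UP_cring_def)
  show ?thesis
    unfolding trunc_poly_ring_def
    by (rule ideal.quotient_is_cring[OF u_ideal_ideal[OF assms] P.is_cring])
qed

lemma scalar_incl_ring_hom:
  assumes "cring F"
  shows "scalar_incl F e \<in> ring_hom F (trunc_poly_ring F e)"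
proof -
  interpret UP_cring F "UP F" using assms by (simp add: UP_cring_def)
  interpret I: ideal "u_ideal F e" "UP F" by (rule u_ideal_ideal[OF assms])
  have "(\<lambda>a. monom (UP F) a 0) \<in> ring_hom F (UP F)"
    by (rule ring_hom_memI) (simp_all add: monom_mult[of _ _ 0 0, simplified] monom_one)
  from ring_hom_trans[OF this I.rcos_ring_hom]
  show ?thesis
    by (simp add: scalar_incl_def[abs_def] trunc_poly_ring_def comp_def)
qed

lemma scalar_incl_Units:
  assumes "field F" and "a \<in> carrier F - {\<zero>\<^bsub>F\<^esub>}"
  shows "scalar_incl F e a \<in> Units (trunc_poly_ring F e)"
proof -
  interpret F: field F by fact
  interpret Q: cring "trunc_poly_ring F e"
    by (rule trunc_poly_ring_is_cring[OF F.is_cring])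
  interpret h: ring_hom_cring F "trunc_poly_ring F e" "scalar_incl F e"
    by unfold_locales (rule scalar_incl_ring_hom[OF F.is_cring])
  have "a \<in> Units F" using assms by (simp add: F.field_Units)
  then obtain b where "b \<in> carrier F" "a \<in> carrier F"
      "b \<otimes>\<^bsub>F\<^esub> a = \<one>\<^bsub>F\<^esub>" "a \<otimes>\<^bsub>F\<^esub> b = \<one>\<^bsub>F\<^esub>"
    by (auto simp: Units_def)
  then show ?thesis
    unfolding Units_def
    by (auto intro!: bexI[of _ "scalar_incl F e b"] simp flip: h.hom_mult)
qed

end

theory Submission
  imports Defs "HOL-Algebra.Multiplicative_Group"
begin

text \<open>If \<open>\<lambda> = \<mu>\<^sup>n\<close> with \<open>\<mu>\<close> a unit, the diagonal map \<open>c \<mapsto> (c\<^sub>0, \<mu> c\<^sub>1, \<dots>, \<mu>\<^sup>n\<^sup>-\<^sup>1 c\<^bsub>n-1\<^esub>)\<close>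
  carries the \<open>\<lambda>\<close>-constacyclic shift to \<open>\<mu>\<close> times the cyclic shift, so it carries
  \<open>\<lambda>\<close>-constacyclic codes to cyclic codes.\<close>

text \<open>Serves as the working form of linearity: \<open>submodule\<close> is traded for
  coordinatewise closure conditions that can be checked on concrete words. Closure under negation is
  absent from the list because it follows from closure under scalars.\<close>

lemma linear_code_iff:
  assumes "cring R"
  shows "linear_code R n C \<longleftrightarrow>
    C \<subseteq> {..<n} \<rightarrow>\<^sub>E carrier R \<and> (\<lambda>i\<in>{..<n}. \<zero>\<^bsub>R\<^esub>) \<in> C \<and>
    (\<forall>x\<in>C. \<forall>y\<in>C. (\<lambda>i\<in>{..<n}. x i \<oplus>\<^bsub>R\<^esub> y i) \<in> C) \<and>
    (\<forall>a\<in>carrier R. \<forall>x\<in>C. (\<lambda>i\<in>{..<n}. a \<otimes>\<^bsub>R\<^esub> x i) \<in> C)" (is "_ = ?R")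
proof -
  let ?M = "free_module R n"
  interpret Module.module R ?M by (rule free_module_is_module[OF assms])
  have simps: "carrier ?M = {..<n} \<rightarrow>\<^sub>E carrier R" "\<zero>\<^bsub>?M\<^esub> = (\<lambda>i\<in>{..<n}. \<zero>\<^bsub>R\<^esub>)"
    "x \<oplus>\<^bsub>?M\<^esub> y = (\<lambda>i\<in>{..<n}. x i \<oplus>\<^bsub>R\<^esub> y i)"
    "a \<odot>\<^bsub>?M\<^esub> x = (\<lambda>i\<in>{..<n}. a \<otimes>\<^bsub>R\<^esub> x i)" for x y a
    by (simp_all add: free_module_def)
  show ?thesis
  proof
    assume "linear_code R n C"
    then have C: "submodule C R ?M" by (simp add: linear_code_def)
    then interpret S: subgroup C "add_monoid ?M" by (simp add: submodule_def)
    show ?R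
      using S.subset S.one_closed S.m_closed submodule.smult_closed[OF C]
      by (simp add: simps)
  next
    assume R: ?R
    have neg: "\<ominus>\<^bsub>?M\<^esub> x \<in> C" if "x \<in> C" for x
    proof -
      have x: "x \<in> carrier ?M" using R that by (auto simp: simps)
      \<comment> \<open>The additive inverse is the multiple by the scalar -1.\<close>
      have "\<ominus>\<^bsub>?M\<^esub> x = (\<ominus>\<^bsub>R\<^esub> \<one>\<^bsub>R\<^esub>) \<odot>\<^bsub>?M\<^esub> x"
        using x by (simp add: smult_l_minus)
      then show ?thesis using R that by (simp add: simps)
    qed
    have "submodule C R ?M"
      using R neg by (intro submoduleI) (auto simp: simps)
    then show "linear_code R n C" by (simp add: linear_code_def)
  qed
qed

text \<open>A monomial map is linear, so it sends submodules to submodules. Commutativity of the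
  ring lets a scalar \<open>b\<close> pass the coefficient \<open>a i\<close>.\<close>

lemma linear_code_monomial_image:
  fixes R (structure)
  assumes "cring R" and C: "linear_code R n C"
    and pi: "\<pi> permutes {..<n}" and a: "a \<in> {..<n} \<rightarrow> carrier R"
  shows "linear_code R n (monomial_map R n \<pi> a ` C)"
proof -
  interpret cring R by fact
  let ?f = "monomial_map R n \<pi> a"
  note C' = C[unfolded linear_code_iff[OF assms(1)]]
  have a': "a i \<in> carrier R" if "i < n" for i using a that by auto
  \<comment> \<open>Restricted words are \<open>undefined\<close> outside \<open>{..<n}\<close>, so
    \<open>\<pi> i\<close> has to stay in range before a word can be evaluated there.\<close>
  have pi': "\<pi> i < n" if "i < n" for i using permutes_in_image[OF pi, of i] that by simp
  have cl: "x i \<in> carrier R" if "x \<in> C" "i < n" for x i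
    using C' that by (auto simp: PiE_iff)
  have zero: "(\<lambda>i\<in>{..<n}. \<zero>) = ?f (\<lambda>i\<in>{..<n}. \<zero>)"
    by (auto simp: monomial_map_def a' pi' intro!: restrict_ext)
  have add: "(\<lambda>i\<in>{..<n}. ?f x i \<oplus> ?f y i) = ?f (\<lambda>i\<in>{..<n}. x i \<oplus> y i)"
    if "x \<in> C" "y \<in> C" for x y
    using that by (auto simp: monomial_map_def a' pi' cl r_distr intro!: restrict_ext)
  have smult: "(\<lambda>i\<in>{..<n}. b \<otimes> ?f x i) = ?f (\<lambda>i\<in>{..<n}. b \<otimes> x i)"
    if "b \<in> carrier R" "x \<in> C" for b x
    using that by (auto simp: monomial_map_def a' pi' cl m_lcomm intro!: restrict_ext)
  show ?thesis
    unfolding linear_code_iff[OF assms(1)]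
  proof (intro conjI ballI)
    show "?f ` C \<subseteq> {..<n} \<rightarrow>\<^sub>E carrier R"
      by (auto simp: monomial_map_def a' pi' cl split: if_splits)
    show "(\<lambda>i\<in>{..<n}. \<zero>) \<in> ?f ` C"
      using C' by (subst zero) blast
  next
    fix u v assume "u \<in> ?f ` C" "v \<in> ?f ` C"
    then obtain x y where "x \<in> C" "y \<in> C" "u = ?f x" "v = ?f y" by blast
    then show "(\<lambda>i\<in>{..<n}. u i \<oplus> v i) \<in> ?f ` C"
      using C' by (simp add: add)
  next
    fix b u assume "b \<in> carrier R" "u \<in> ?f ` C"
    moreover from this obtain x where "x \<in> C" "u = ?f x" by blast
    ultimately show "(\<lambda>i\<in>{..<n}. b \<otimes> u i) \<in> ?f ` C"
      using C' by (simp add: smult)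
  qed
qed

text \<open>Shifting by one position leaves each exponent of \<open>\<mu>\<close> one short of its
  new index, and \<open>inv \<mu>\<close> absorbs the difference. That factor sits inside the
  argument of the diagonal map, so that the argument is visibly a scalar multiple of a shifted
  word.\<close>

lemma cyclic_shift_diagonal:
  fixes R (structure)
  assumes "cring R" and mu: "\<mu> \<in> Units R" and c: "c \<in> {..<n} \<rightarrow> carrier R"
  shows "constacyclic_shift R n \<one> (monomial_map R n id (\<lambda>i. \<mu> [^] i) c) =
    monomial_map R n id (\<lambda>i. \<mu> [^] i)
      (\<lambda>i\<in>{..<n}. inv \<mu> \<otimes> constacyclic_shift R n (\<mu> [^] n) c i)"
proof -
  interpret cring R by fact
  have mu': "\<mu> \<in> carrier R" "inv \<mu> \<in> carrier R" using mu by auto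
  have c': "c i \<in> carrier R" if "i < n" for i using c that by auto
  have pow: "\<mu> [^] Suc k \<otimes> (inv \<mu> \<otimes> x) = \<mu> [^] k \<otimes> x" if "x \<in> carrier R" for k x
  proof -
    have "\<mu> [^] Suc k \<otimes> (inv \<mu> \<otimes> x) = \<mu> [^] k \<otimes> ((\<mu> \<otimes> inv \<mu>) \<otimes> x)"
      using mu' that by (simp add: m_assoc)
    then show ?thesis using mu that by simp
  qed
  \<comment> \<open>The wrap-around coordinate: its new index is 0, so the diagonal contributes
    nothing and the constant \<open>\<mu> [^] n\<close> supplies the power. Here \<open>n\<close>
    must be a successor.\<close>
  have "\<mu> [^] (n - 1) \<otimes> c (n - 1) = inv \<mu> \<otimes> (\<mu> [^] n \<otimes> c (n - 1))" if "0 < n"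
    using pow[of "c (n - 1)" "n - 1"] c'[of "n - 1"] mu' that
    by (simp add: m_lcomm)
  moreover have "\<mu> [^] (i - 1) \<otimes> c (i - 1) = \<mu> [^] i \<otimes> (inv \<mu> \<otimes> c (i - 1))"
    if "0 < i" "i < n" for i
    using pow[of "c (i - 1)" "i - 1"] c'[of "i - 1"] that by simp
  ultimately show ?thesis
    using mu' c' by (auto simp: constacyclic_shift_def monomial_map_def intro!: restrict_ext)
qed

text \<open>Stated over any commutative ring: all that matters is that the shift constant is an
  \<open>n\<close>-th power of a unit.\<close>

theorem constacyclic_code_equivalent_cyclic:
  fixes R (structure)
  assumes "cring R" and mu: "\<mu> \<in> Units R"
    and C: "constacyclic_code R n (\<mu> [^] n) C"
  shows "\<exists>D. cyclic_code R n D \<and> equivalent_codes R n C D"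
proof -
  interpret cring R by fact
  let ?f = "monomial_map R n id (\<lambda>i. \<mu> [^] i)"
  have lin: "linear_code R n C" and shift: "\<And>c. c \<in> C \<Longrightarrow> constacyclic_shift R n (\<mu> [^] n) c \<in> C"
    using C by (auto simp: constacyclic_code_def)
  note lin' = lin[unfolded linear_code_iff[OF assms(1)]]
  have "linear_code R n (?f ` C)"
    using mu by (intro linear_code_monomial_image lin assms(1) permutes_id) auto
  \<comment> \<open>By the diagonal identity the preimage is \<open>inv \<mu>\<close> times the
    constacyclic shift of \<open>c\<close>, which lies in \<open>C\<close> by shift closure and
    linearity.\<close>
  moreover have "constacyclic_shift R n \<one> (?f c) \<in> ?f ` C" if "c \<in> C" for c
  proof (subst cyclic_shift_diagonal[OF assms(1) mu])
    show "c \<in> {..<n} \<rightarrow> carrier R" using lin' that by auto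
  qed (use lin' shift[OF that] mu in auto)
  ultimately have "cyclic_code R n (?f ` C)"
    and "linear_code R n (?f ` C)"
    by (auto simp: cyclic_code_def constacyclic_code_def)
  moreover from this have "equivalent_codes R n C (?f ` C)"
    unfolding equivalent_codes_def
    using lin mu Units_pow_closed by (intro conjI exI[of _ id] exI[of _ "\<lambda>i. \<mu> [^] i"]) (auto simp: permutes_id)
  ultimately show ?thesis by blast
qed

theorem proposition3p10:
  fixes F :: "('a, 'b) ring_scheme"
    and p r e m s n :: nat
    and l :: 'a
  assumes "prime p"
    and "r \<ge> 1" and "e \<ge> 1" and "m \<ge> 1"
    and "coprime m p"
    and "n = m * p ^ s"
    and "field F" and "order F = p ^ r"
    and "l \<in> carrier F - {\<zero>\<^bsub>F\<^esub>}"
    and "\<exists>\<mu>\<in>carrier F. l = \<mu> [^]\<^bsub>F\<^esub> (p ^ s * m)"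
  shows "\<forall>C. constacyclic_code (trunc_poly_ring F e) n (scalar_incl F e l) C \<longrightarrow>
    (\<exists>D. cyclic_code (trunc_poly_ring F e) n D \<and> equivalent_codes (trunc_poly_ring F e) n C D)"
proof -
  interpret F: field F by fact
  let ?R = "trunc_poly_ring F e"
  interpret R: cring ?R by (rule trunc_poly_ring_is_cring[OF F.is_cring])
  interpret h: ring_hom_cring F ?R "scalar_incl F e"
    by unfold_locales (rule scalar_incl_ring_hom[OF F.is_cring])
  obtain \<mu> where mu: "\<mu> \<in> carrier F" and l: "l = \<mu> [^]\<^bsub>F\<^esub> n"
    using assms(10) \<open>n = m * p ^ s\<close> by (auto simp: mult.commute)
  \<comment> \<open>Positivity rules out \<open>\<mu>\<close> being zero: a zero base has power zero
    for a positive exponent, but power one for exponent 0.\<close>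
  have "n > 0" using \<open>prime p\<close> \<open>m \<ge> 1\<close> \<open>n = m * p ^ s\<close> by (simp add: prime_gt_0_nat)
  then have "\<mu> \<noteq> \<zero>\<^bsub>F\<^esub>" using l assms(9) by (auto simp: F.nat_pow_zero)
  then have unit: "scalar_incl F e \<mu> \<in> Units ?R"
    using mu by (intro scalar_incl_Units assms) auto
  \<comment> \<open>The inclusion is a ring homomorphism, so the root found in the field becomes a
    unit root in the quotient ring.\<close>
  have "scalar_incl F e l = scalar_incl F e \<mu> [^]\<^bsub>?R\<^esub> n"
    using mu l by (simp add: h.hom_pow)
  then show ?thesis
    using constacyclic_code_equivalent_cyclic[OF R.is_cring unit] by simp
qed

end
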